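(* For every positive integer $n$, $$\widetilde{B}^+_n(t) = \sum_{i=0}^{\lfloor n/2 \rfloor} \widetilde{\gamma}^+_{n,2,i}\, t^i (1+t)^{n-2i}, \qquad \widetilde{B}^-_n(t) = \sum_{i=1}^{\lfloor (n+1)/2 \rfloor} \widetilde{\gamma}^-_{n,2,i}\, t^i (1+t)^{n+1-2i},$$ where (i) $\widetilde{\gamma}^+_{n,2,i}$ is equal to the number of signed permutations $w \in \mathbb{Z}_2 \wr \mathfrak{S}_n$ for which $\mathrm{Des}_B(w)$ is a set of $i$ elements, no two consecutive, and does not contain $n$; (ii) $\widetilde{\gamma}^-_{n,2,i}$ is equal to the number of signed permutations $w \in \mathbb{Z}_2 \wr \mathfrak{S}_n$ for which $\mathrm{Des}_B(w)$ is a set of $i$ elements, no two consecutive, and contains $n$.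
   Context: **Type $B$ binomial Eulerian polynomials.** Elements of $\mathbb{Z}_2 \wr \mathfrak{S}_n$ can be represented as pairs $(\sigma,\varepsilon)$ with $\sigma\in\mathfrak{S}_n$, $\varepsilon\in\{0,1\}^n$. An index $k\in\{1,\dots,n\}$ is a descent if $\varepsilon_k > \varepsilon_{k+1}$, or $\varepsilon_k=\varepsilon_{k+1}$ and $\sigma(k)>\sigma(k+1)$, where $\sigma(n+1):=n+1$, $\varepsilon_{n+1}:=0$; $\mathrm{des}$ is the number of descents. Let $B_n(t) = \sum_{w\in\mathbb{Z}_2\wr\mathfrak{S}_n} t^{\mathrm{des}(w)}$, $B_0(t)=1$, and $\widetilde{B}_n(t) = \sum_{m=0}^n \binom{n}{m} t^{n-m} B_m(t)$. The polynomials $\widetilde{B}^+_n(t)$ and $\widetilde{B}^-_n(t)$ are the unique polynomials with $\widetilde{B}_n(t) = \widetilde{B}^+_n(t)+\widetilde{B}^-_n(t)$ such that $\widetilde{B}^+_n(t)$ is palindromic with center $n/2$ (i.e. $t^n\widetilde{B}^+_n(1/t) = \widetilde{B}^+_n(t)$) and $\widetilde{B}^-_n(t)$ is palindromic with center $(n+1)/2$ (i.e. $t^{n+1}\widetilde{B}^-_n(1/t) = \widetilde{B}^-_n(t)$). **The set $\mathrm{Des}_B$.** Here a signed permutation $w\in\mathbb{Z}_2\wr\mathfrak{S}_n$ is written as a sequence $(w(1),\dots,w(n))$ of nonzero integers such that $(|w(1)|,\dots,|w(n)|)$ is a permutation of $\{1,\dots,n\}$. $\mathrm{Des}_B(w)$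 is the set of indices $i\in\{1,\dots,n\}$ for which either $w(i)$ is positive and $w(i)>w(i+1)$, or else both $w(i)$ and $w(i+1)$ are negative and $|w(i)|>|w(i+1)|$, where $w(n+1):=0$. *)

theory Defs
  imports
    Complex_Main
    "HOL-Computational_Algebra.Polynomial"
    "HOL-Combinatorics.Permutations"
begin

text \<open>
  The wreath product of the group of order two with the symmetric group, as pairs. Both components
  are normalised outside \<open>{1..n}\<close>: there \<open>\<sigma>\<close> is the identity and \<open>\<epsilon>\<close> is zero, which in particular
  gives the boundary conventions \<open>\<sigma> (n + 1) = n + 1\<close> and \<open>\<epsilon> (n + 1) = 0\<close>.
\<close>

definition colored_perms :: "nat \<Rightarrow> ((nat \<Rightarrow> nat) \<times> (nat \<Rightarrow> nat)) set" where
  "colored_perms n =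
     {(\<sigma>, \<epsilon>). \<sigma> permutes {1..n} \<and> (\<forall>k\<in>{1..n}. \<epsilon> k \<in> {0, 1}) \<and> (\<forall>k. k \<notin> {1..n} \<longrightarrow> \<epsilon> k = 0)}"

definition colored_des :: "nat \<Rightarrow> (nat \<Rightarrow> nat) \<times> (nat \<Rightarrow> nat) \<Rightarrow> nat" where
  "colored_des n = (\<lambda>(\<sigma>, \<epsilon>).
     card {k \<in> {1..n}. \<epsilon> k > \<epsilon> (k + 1) \<or> (\<epsilon> k = \<epsilon> (k + 1) \<and> \<sigma> k > \<sigma> (k + 1))})"

definition B_poly :: "nat \<Rightarrow> real poly" where
  "B_poly n = (\<Sum>w\<in>colored_perms n. [:0, 1:] ^ colored_des n w)"

definition B_tilde :: "nat \<Rightarrow> real poly" where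
  "B_tilde n = (\<Sum>m\<le>n. of_nat (n choose m) * [:0, 1:] ^ (n - m) * B_poly m)"

definition palindromic :: "nat \<Rightarrow> real poly \<Rightarrow> bool"
  \<comment> \<open>palindromic with center \<open>N / 2\<close>\<close>
  where "palindromic N p \<longleftrightarrow> (\<forall>t. t \<noteq> 0 \<longrightarrow> t ^ N * poly p (1 / t) = poly p t)"

definition palindromic_decomp :: "nat \<Rightarrow> real poly \<Rightarrow> real poly \<Rightarrow> real poly \<Rightarrow> bool" where
  "palindromic_decomp n f p q \<longleftrightarrow> f = p + q \<and> palindromic n p \<and> palindromic (n + 1) q"

text \<open>The descriptions are proper by lemma \<open>B_tilde_decomp_ex1\<close> below.\<close>

definition B_tilde_plus :: "nat \<Rightarrow> real poly" where
  "B_tilde_plus n = (THE p. \<exists>q. palindromic_decomp n (B_tilde n) p q)"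

definition B_tilde_minus :: "nat \<Rightarrow> real poly" where
  "B_tilde_minus n = (THE q. \<exists>p. palindromic_decomp n (B_tilde n) p q)"

text \<open>
  Signed permutations as sequences of nonzero integers, extended by zero outside \<open>{1..n}\<close>, so that
  \<open>w (n + 1) = 0\<close>.
\<close>

definition signed_perms :: "nat \<Rightarrow> (nat \<Rightarrow> int) set" where
  "signed_perms n =
     {w. bij_betw (\<lambda>i. nat \<bar>w i\<bar>) {1..n} {1..n} \<and> (\<forall>i. i \<notin> {1..n} \<longrightarrow> w i = 0)}"

definition Des_B :: "nat \<Rightarrow> (nat \<Rightarrow> int) \<Rightarrow> nat set" where
  "Des_B n w = {i \<in> {1..n}. (w i > 0 \<and> w i > w (i + 1)) \<or>
                            (w i < 0 \<and> w (i + 1) < 0 \<and> \<bar>w i\<bar> > \<bar>w (i + 1)\<bar>)}"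

definition no_two_consecutive :: "nat set \<Rightarrow> bool" where
  "no_two_consecutive S \<longleftrightarrow> (\<forall>i. \<not> (i \<in> S \<and> i + 1 \<in> S))"

definition gamma_plus :: "nat \<Rightarrow> nat \<Rightarrow> nat" where
  "gamma_plus n i = card {w \<in> signed_perms n.
     card (Des_B n w) = i \<and> no_two_consecutive (Des_B n w) \<and> n \<notin> Des_B n w}"

definition gamma_minus :: "nat \<Rightarrow> nat \<Rightarrow> nat" where
  "gamma_minus n i = card {w \<in> signed_perms n.
     card (Des_B n w) = i \<and> no_two_consecutive (Des_B n w) \<and> n \<in> Des_B n w}"

lemma colored_perms_0: "colored_perms 0 = {(id, \<lambda>_. 0)}"
  by (auto simp: colored_perms_def)

lemma B_poly_0: "B_poly 0 = 1"
  by (simp add: B_poly_def colored_perms_0 colored_des_def)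

lemma finite_colored_perms: "finite (colored_perms n)"
proof (rule finite_subset)
  show "colored_perms n \<subseteq> {\<sigma>. \<sigma> permutes {1..n}} \<times>
      {\<epsilon>. \<forall>k. (k \<in> {1..n} \<longrightarrow> \<epsilon> k \<in> {0, 1}) \<and> (k \<notin> {1..n} \<longrightarrow> \<epsilon> k = 0)}"
    by (auto simp: colored_perms_def)
  show "finite \<dots>"
    by (intro finite_cartesian_product finite_permutations finite_set_of_finite_funs) auto
qed

lemma finite_signed_perms: "finite (signed_perms n)"
proof (rule finite_subset)
  have "w i \<in> {- int n..int n}" if "w \<in> signed_perms n" "i \<in> {1..n}" for w i
  proof -
    have "nat \<bar>w i\<bar> \<in> {1..n}"
      using that by (auto simp: signed_perms_def dest: bij_betwE)
    then show ?thesis by auto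
  qed
  then show "signed_perms n \<subseteq>
      {w. \<forall>k. (k \<in> {1..n} \<longrightarrow> w k \<in> {- int n..int n}) \<and> (k \<notin> {1..n} \<longrightarrow> w k = 0)}"
    by (auto simp: signed_perms_def)
  show "finite \<dots>"
    by (intro finite_set_of_finite_funs) auto
qed

lemma degree_B_poly: "degree (B_poly n) \<le> n"
  unfolding B_poly_def
proof (rule degree_sum_le[OF finite_colored_perms])
  fix w
  have "colored_des n w \<le> card {1..n}"
    unfolding colored_des_def case_prod_beta by (rule card_mono) auto
  moreover have "degree ([:0, 1:] ^ colored_des n w :: real poly) = colored_des n w"
    by (simp add: degree_power_eq)
  ultimately show "degree ([:0, 1:] ^ colored_des n w :: real poly) \<le> n" by simp
qed

lemma degree_B_tilde: "degree (B_tilde n) \<le> n"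
  unfolding B_tilde_def
proof (rule degree_sum_le)
  fix m assume m: "m \<in> {..n}"
  have "degree (of_nat (n choose m) * [:0, 1:] ^ (n - m) * B_poly m)
      \<le> degree (of_nat (n choose m) * [:0, 1:] ^ (n - m) :: real poly) + degree (B_poly m)"
    by (rule degree_mult_le)
  also have "degree (of_nat (n choose m) * [:0, 1:] ^ (n - m) :: real poly)
      \<le> degree (of_nat (n choose m) :: real poly) + degree ([:0, 1:] ^ (n - m) :: real poly)"
    by (rule degree_mult_le)
  also have "degree ([:0, 1:] ^ (n - m) :: real poly) = n - m"
    by (simp add: degree_power_eq)
  finally show "degree (of_nat (n choose m) * [:0, 1:] ^ (n - m) * B_poly m) \<le> n"
    using degree_B_poly[of m] m by simp
qed simp

lemma poly_eq_off_01:
  fixes p q :: "real poly"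
  assumes "\<And>t. t \<noteq> 0 \<Longrightarrow> t \<noteq> 1 \<Longrightarrow> poly p t = poly q t"
  shows "p = q"
proof (rule ccontr)
  assume "p \<noteq> q"
  then have "finite {t. poly (p - q) t = 0}" by (intro poly_roots_finite) simp
  moreover have "UNIV - {0, 1} \<subseteq> {t. poly (p - q) t = 0}" using assms by auto
  ultimately have "finite (UNIV - {0, 1 :: real})" by (rule rev_finite_subset)
  then show False by (simp add: infinite_UNIV_char_0)
qed

lemma palindromic_decomp_unique:
  assumes "palindromic_decomp n f p q" "palindromic_decomp n f p' q'"
  shows "p = p' \<and> q = q'"
proof -
  have eq: "p - p' = q' - q"
    using assms by (simp add: palindromic_decomp_def algebra_simps)
  have "p - p' = 0"
  proof (rule poly_eq_off_01)
    fix t :: real assume t: "t \<noteq> 0" "t \<noteq> 1"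
    have "t ^ n * poly (p - p') (1 / t) = poly (p - p') t"
      using assms t by (simp add: palindromic_decomp_def palindromic_def algebra_simps)
    moreover have "t * (t ^ n * poly (q' - q) (1 / t)) = poly (q' - q) t"
      using assms t by (simp add: palindromic_decomp_def palindromic_def algebra_simps)
    ultimately have "t * poly (p - p') t = poly (p - p') t" using eq by simp
    with t show "poly (p - p') t = poly 0 t" by simp
  qed
  with eq show ?thesis by simp
qed

lemma palindromic_decomp_exists:
  assumes "degree f \<le> n"
  shows "\<exists>p q. palindromic_decomp n f p q"
proof -
  define g :: "real poly" where "g = (\<Sum>j\<le>n. monom (coeff f j) (n + 1 - j))"
  have g: "poly g t = t ^ (n + 1) * poly f (1 / t)" if "t \<noteq> 0" for t
  proof -
    have "poly f (1 / t) = (\<Sum>j\<le>n. coeff f j * (1 / t) ^ j)"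
      unfolding poly_altdef using assms
      by (intro sum.mono_neutral_left) (auto simp: coeff_eq_0)
    then show ?thesis
      using that by (simp add: g_def poly_sum poly_monom sum_distrib_left power_divide
          power_diff mult_ac del: power_Suc)
  qed
  have g': "t ^ (n + 1) * poly g (1 / t) = poly f t" if "t \<noteq> 0" for t
    using g[of "1 / t"] that by (simp add: power_divide del: power_Suc)
  have "poly (f - g) 1 = 0" "poly (g - [:0, 1:] * f) 1 = 0"
    using g[of 1] by simp_all
  then obtain p q where p: "f - g = [:-1, 1:] * - p" and q: "g - [:0, 1:] * f = [:-1, 1:] * - q"
    by (metis poly_eq_0_iff_dvd dvdE minus_minus)
  have pt: "(1 - t) * poly p t = poly f t - poly g t" for t
    using arg_cong[OF p, of "\<lambda>r. poly r t"] by (simp add: algebra_simps)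
  have qt: "(1 - t) * poly q t = poly g t - t * poly f t" for t
    using arg_cong[OF q, of "\<lambda>r. poly r t"] by (simp add: algebra_simps)
  have "f = p + q"
  proof (rule poly_eq_off_01)
    fix t :: real assume t: "t \<noteq> 0" "t \<noteq> 1"
    have "(1 - t) * poly (p + q) t = (1 - t) * poly f t"
      using pt[of t] qt[of t] by (simp add: algebra_simps)
    with t show "poly f t = poly (p + q) t" by simp
  qed
  moreover have "palindromic n p"
    unfolding palindromic_def
  proof (intro allI impI)
    fix t :: real assume t: "t \<noteq> 0"
    show "t ^ n * poly p (1 / t) = poly p t"
    proof (cases "t = 1")
      case False
      have "(t - 1) * (t ^ n * poly p (1 / t)) = t ^ (n + 1) * ((1 - 1 / t) * poly p (1 / t))"
        using t by (simp add: field_simps)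
      also have "\<dots> = t ^ (n + 1) * poly f (1 / t) - t ^ (n + 1) * poly g (1 / t)"
        unfolding pt by (rule right_diff_distrib)
      also have "\<dots> = (t - 1) * poly p t"
        using pt[of t] g[OF t] g'[OF t] by (simp add: algebra_simps)
      finally show ?thesis using False by simp
    qed simp
  qed
  moreover have "palindromic (n + 1) q"
    unfolding palindromic_def
  proof (intro allI impI)
    fix t :: real assume t: "t \<noteq> 0"
    show "t ^ (n + 1) * poly q (1 / t) = poly q t"
    proof (cases "t = 1")
      case False
      have "(t - 1) * (t ^ (n + 1) * poly q (1 / t))
          = t * (t ^ (n + 1) * ((1 - 1 / t) * poly q (1 / t)))"
        using t by (simp add: field_simps)
      also have "\<dots> = t * (t ^ (n + 1) * poly g (1 / t)) - t ^ (n + 1) * poly f (1 / t)"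
        unfolding qt using t by (simp add: field_simps)
      also have "\<dots> = (t - 1) * poly q t"
        using qt[of t] g[OF t] g'[OF t] by (simp add: algebra_simps)
      finally show ?thesis using False by simp
    qed simp
  qed
  ultimately show ?thesis unfolding palindromic_decomp_def by blast
qed

lemma B_tilde_decomp_ex1: "\<exists>!(p, q). palindromic_decomp n (B_tilde n) p q"
  using palindromic_decomp_exists[OF degree_B_tilde, of n]
    palindromic_decomp_unique[of n "B_tilde n"] by blast

lemma B_tilde_decomp: "palindromic_decomp n (B_tilde n) (B_tilde_plus n) (B_tilde_minus n)"
proof -
  obtain p q where pq: "palindromic_decomp n (B_tilde n) p q"
    using palindromic_decomp_exists[OF degree_B_tilde] by blast
  have "B_tilde_plus n = p"
    unfolding B_tilde_plus_def using pq palindromic_decomp_unique by blast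
  moreover have "B_tilde_minus n = q"
    unfolding B_tilde_minus_def using pq palindromic_decomp_unique by blast
  ultimately show ?thesis using pq by simp
qed

end

theory Submission
  imports Defs "HOL-Combinatorics.Multiset_Permutations" "HOL-Library.Product_Lexorder"
begin

text \<open>
  In the order \<open>-1 < \<dots> < -n < 0 < 1 < \<dots> < n\<close> both descent sets of the theorem are ordinary descent
  sets of words that end in the letter \<open>0\<close>. For a set \<open>X\<close> of letters and an end letter \<open>e\<close>, cutting
  the words at the least letter of \<open>X\<close> gives a recurrence for the descent generating function
  \<open>D X e\<close>, and the same cut gives a recurrence for the generating function \<open>G X e\<close> of words without
  double descents, weighted by \<open>t^i (1 + t)^j\<close>. If \<open>e\<close> lies below \<open>X\<close> the two coincide. In general
  the recurrences differ by a term \<open>t\<close> for each cut with an empty left part, whence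
  \<open>G X e = (\<Sum>J \<subseteq> {x \<in> X. x < e}. t ^ card J * D (X - J) e)\<close>. Summation over all choices of signs
  turns the right-hand side into \<open>B_tilde\<close>; the two sums in the theorem are the parts of \<open>G\<close>
  in which the last position is or is not a descent, and both are visibly palindromic.
\<close>

section \<open>Descent sets of words\<close>

definition descents :: "'a::linorder list \<Rightarrow> nat set" where
  "descents xs = {i. Suc i < length xs \<and> xs ! i > xs ! Suc i}"

lemma descents_Nil [simp]: "descents [] = {}"
  and descents_single [simp]: "descents [x] = {}"
  by (auto simp: descents_def)

lemma descents_Cons_Cons:
  "descents (x # y # zs) = (if x > y then {0} else {}) \<union> Suc ` descents (y # zs)"
proof (rule set_eqI)
  fix i show "i \<in> descents (x # y # zs) \<longleftrightarrow>
      i \<in> (if x > y then {0} else {}) \<union> Suc ` descents (y # zs)"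
    by (cases i) (auto simp: descents_def)
qed

lemma finite_descents [simp]: "finite (descents xs)"
  by (rule finite_subset[of _ "{..<length xs}"]) (auto simp: descents_def)

lemma card_descents_Cons_Cons:
  "card (descents (x # y # zs)) = (if x > y then 1 else 0) + card (descents (y # zs))"
  by (simp add: descents_Cons_Cons card_image)

text \<open>The letter \<open>m\<close> is shared by both factors, so every adjacent pair of the
  word lies in exactly one of them.\<close>

lemma card_descents_append:
  "card (descents (xs @ m # ys)) = card (descents (xs @ [m])) + card (descents (m # ys))"
proof (induction xs)
  case (Cons x xs)
  then show ?case by (cases xs) (simp_all add: card_descents_Cons_Cons)
qed simp

lemma card_descents_Cons_less:
  assumes "ys \<noteq> []" "m < hd ys"
  shows "card (descents (m # ys)) = card (descents ys)"
  using assms by (cases ys) (auto simp: card_descents_Cons_Cons)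

text \<open>Only the last comparison sees the end letter, and it is a descent for either
  choice.\<close>

lemma card_descents_below_cong:
  assumes "\<forall>x\<in>set xs. m < x" "\<forall>x\<in>set xs. e < x"
  shows "card (descents (xs @ [m])) = card (descents (xs @ [e]))"
  using assms
proof (induction xs)
  case (Cons x xs)
  then show ?case by (cases xs) (simp_all add: card_descents_Cons_Cons)
qed simp

lemma descents_map:
  assumes "strict_mono_on A f" "set xs \<subseteq> A"
  shows "descents (map f xs) = descents xs"
proof -
  have "f (xs ! Suc i) < f (xs ! i) \<longleftrightarrow> xs ! Suc i < xs ! i" if "Suc i < length xs" for i
    using assms that by (intro strict_mono_on_less) (auto dest: nth_mem)
  then show ?thesis by (auto simp: descents_def)
qed

section \<open>The weight of words without double descents\<close>

text \<open>
  A descent pairs up its two letters with weight \<open>t\<close>; every other letter except an unpaired last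
  one has weight \<open>1 + t\<close>; double descents have weight \<open>0\<close>.
\<close>

fun gamma_weight :: "'b::comm_semiring_1 \<Rightarrow> 'a::linorder list \<Rightarrow> 'b" where
  "gamma_weight t [] = 1"
| "gamma_weight t [x] = 1"
| "gamma_weight t [x, y] = (if x > y then t else 1 + t)"
| "gamma_weight t (x # y # z # zs) =
     (if x > y then if y > z then 0 else t * gamma_weight t (z # zs)
      else (1 + t) * gamma_weight t (y # z # zs))"

text \<open>If \<open>xs\<close> is nonempty, its last letter or an earlier double descent settles
  the weight up to \<open>m\<close>, and since \<open>m < hd ys\<close> the word \<open>ys\<close>
  is weighted afresh. If \<open>xs\<close> is empty, \<open>m\<close> is unpaired but not last, so
  it weighs \<open>1 + t\<close> instead of the \<open>1\<close> of \<open>[m]\<close>; this surplus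
  \<open>t\<close> is the source of the correction terms below.\<close>

lemma gamma_weight_append:
  assumes "\<forall>x\<in>set xs. m < x" "ys \<noteq> []" "m < hd ys"
  shows "gamma_weight t (xs @ m # ys) =
    (if xs = [] then 1 + t else gamma_weight t (xs @ [m])) * gamma_weight t ys"
proof -
  obtain y ys' where ys: "ys = y # ys'" using assms by (cases ys) auto
  have my: "m < y" using assms ys by simp
  show ?thesis using assms(1) unfolding ys
  proof (induction t xs rule: gamma_weight.induct)
    case (1 t)
    then show ?case using my by (cases ys') auto
  next
    case (2 t x)
    then show ?case using my by auto
  next
    case (3 t x y)
    then show ?case using my by (auto simp: mult_ac)
  next
    case (4 t x y z zs)
    then show ?case using my by (cases zs) (auto simp: mult_ac)
  qed
qed

text \<open>Any letter directly before \<open>m\<close> forms a double descent with \<open>m\<close>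
  and \<open>e\<close>, so only the word \<open>[m, e]\<close> survives.\<close>

lemma gamma_weight_double_descent:
  assumes "\<forall>x\<in>set xs. m < x" "e < m"
  shows "gamma_weight t (xs @ [m, e]) = (if xs = [] then t else 0)"
  using assms by (induction t xs rule: gamma_weight.induct) auto

lemma no_two_consecutive_descents_Cons:
  "no_two_consecutive (descents (x # y # zs)) \<longleftrightarrow>
     no_two_consecutive (descents (y # zs)) \<and> \<not> (x > y \<and> 0 \<in> descents (y # zs))"
proof -
  have "xa = 0 \<or> 0 < xa" for xa :: nat by auto
  then show ?thesis
    by (auto simp: no_two_consecutive_def descents_Cons_Cons) (metis neq0_conv)+
qed

lemma zero_in_descents: "0 \<in> descents (x # y # zs) \<longleftrightarrow> x > y"
  by (auto simp: descents_Cons_Cons)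

text \<open>The index is that of the last letter but one. On shorter words the truncated difference
  is \<open>0\<close>, which is harmless because they have no descents.\<close>

definition descent_at_end :: "'a::linorder list \<Rightarrow> bool" where
  "descent_at_end xs \<longleftrightarrow> length xs - 2 \<in> descents xs"

lemma descent_at_end_simps [simp]:
  "\<not> descent_at_end []" "\<not> descent_at_end [x]"
  "descent_at_end [x, y] \<longleftrightarrow> x > y"
  "descent_at_end (x # y # z # zs) \<longleftrightarrow> descent_at_end (y # z # zs)"
  by (auto simp: descent_at_end_def descents_def)

text \<open>The exponent of \<open>1 + t\<close> counts the unpaired letters other than the last
  one: \<open>length xs - 1\<close> leaves the last letter out, and \<open>of_bool\<close> puts it
  back if it is paired, since it is then subtracted with its pair. The inequality belongs to the
  claim because it makes the truncated exponent exact, also within the induction.\<close>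

lemma gamma_weight_closed_form:
  assumes "xs \<noteq> []"
  shows "gamma_weight t xs =
      (if no_two_consecutive (descents xs) then
         t ^ card (descents xs) *
         (1 + t) ^ (length xs - 1 + of_bool (descent_at_end xs) - 2 * card (descents xs))
       else 0) \<and>
    (no_two_consecutive (descents xs) \<longrightarrow>
      2 * card (descents xs) \<le> length xs - 1 + of_bool (descent_at_end xs))"
  using assms
proof (induction t xs rule: gamma_weight.induct)
  case (4 t x y z zs)
  show ?case
  proof (cases "x > y")
    case True
    show ?thesis
    proof (cases "y > z")
      case True
      then show ?thesis using \<open>x > y\<close>
        by (simp add: no_two_consecutive_descents_Cons zero_in_descents)
    next
      case False
      \<comment> \<open>If \<open>zs\<close> is empty, \<open>y\<close> and \<open>z\<close> form
        the last pair, which is no descent, so dropping \<open>y\<close> changes nothing.\<close>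
      have "descent_at_end (y # z # zs) \<longleftrightarrow> descent_at_end (z # zs)"
        using False by (cases zs) auto
      then show ?thesis using 4 True False
        by (simp add: no_two_consecutive_descents_Cons zero_in_descents card_descents_Cons_Cons
            mult_ac)
    qed
  next
    case False
    then have "gamma_weight t (x # y # z # zs) = (1 + t) * gamma_weight t (y # z # zs)"
      "card (descents (x # y # z # zs)) = card (descents (y # z # zs))"
      "no_two_consecutive (descents (x # y # z # zs)) = no_two_consecutive (descents (y # z # zs))"
      by (simp_all add: no_two_consecutive_descents_Cons[of x] card_descents_Cons_Cons[of x])
    \<comment> \<open>By the inequality in the induction hypothesis, the additional letter raises
      the truncated exponent by exactly one.\<close>
    then show ?thesis using 4(2) False
      by (auto simp: mult_ac Suc_diff_le)
  qed
qed (auto simp: no_two_consecutive_def card_descents_Cons_Cons descents_Cons_Cons)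

section \<open>Generating functions and the cut at the least letter\<close>

definition des_sum :: "'b::comm_semiring_1 \<Rightarrow> 'a::linorder set \<Rightarrow> 'a \<Rightarrow> 'b" where
  "des_sum t X e = (\<Sum>xs\<in>permutations_of_set X. t ^ card (descents (xs @ [e])))"

definition gamma_sum :: "'b::comm_semiring_1 \<Rightarrow> 'a::linorder set \<Rightarrow> 'a \<Rightarrow> 'b" where
  "gamma_sum t X e = (\<Sum>xs\<in>permutations_of_set X. gamma_weight t (xs @ [e]))"

lemma des_sum_empty [simp]: "des_sum t {} e = 1"
  by (simp add: des_sum_def)

lemma gamma_sum_empty [simp]: "gamma_sum t {} e = 1"
  by (simp add: gamma_sum_def)

text \<open>The letter \<open>m\<close> occurs exactly once, so cutting there is a bijection onto
  the triples of a set \<open>U\<close> of left letters, an arrangement of \<open>U\<close> and one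
  of \<open>Y - U\<close>.\<close>

lemma sum_permutations_of_set_insert:
  assumes "finite Y" "m \<notin> Y"
  shows "(\<Sum>xs\<in>permutations_of_set (insert m Y). F xs) =
    (\<Sum>U\<in>Pow Y. \<Sum>us\<in>permutations_of_set U. \<Sum>vs\<in>permutations_of_set (Y - U). F (us @ m # vs))"
proof -
  let ?S = "SIGMA U:Pow Y. permutations_of_set U \<times> permutations_of_set (Y - U)"
  let ?g = "\<lambda>(U, us, vs). us @ m # vs"
  have "inj_on ?g ?S"
  proof (rule inj_onI)
    fix p p' assume pp: "p \<in> ?S" "p' \<in> ?S" "?g p = ?g p'"
    obtain U us vs where p: "p = (U, us, vs)" by (cases p)
    obtain U' us' vs' where p': "p' = (U', us', vs')" by (cases p')
    have A: "U \<subseteq> Y" "us \<in> permutations_of_set U" "vs \<in> permutations_of_set (Y - U)"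
      "U' \<subseteq> Y" "us' \<in> permutations_of_set U'" "vs' \<in> permutations_of_set (Y - U')"
      and eq: "us @ m # vs = us' @ m # vs'" using pp p p' by auto
    have "m \<notin> set us" "m \<notin> set us'" "m \<notin> set vs" "m \<notin> set vs'"
      using A assms by (auto simp: permutations_of_set_def)
    then have "us = us' \<and> vs = vs'" using eq by (auto simp: append_Cons_eq_iff)
    then show "p = p'" using A p p' by (auto simp: permutations_of_set_def)
  qed
  moreover have "?g ` ?S = permutations_of_set (insert m Y)"
  proof (intro equalityI subsetI)
    fix xs assume "xs \<in> permutations_of_set (insert m Y)"
    then have xs: "set xs = insert m Y" "distinct xs" by (auto simp: permutations_of_set_def)
    then obtain us vs where uv: "xs = us @ m # vs" by (metis insertI1 split_list)
    have "(set us, us, vs) \<in> ?S" using xs uv assms by (auto simp: permutations_of_set_def)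
    then show "xs \<in> ?g ` ?S" by (rule rev_image_eqI) (simp add: uv)
  next
    fix xs assume "xs \<in> ?g ` ?S"
    then show "xs \<in> permutations_of_set (insert m Y)"
      using assms by (auto simp: permutations_of_set_def)
  qed
  ultimately have "(\<Sum>xs\<in>permutations_of_set (insert m Y). F xs) = (\<Sum>p\<in>?S. F (?g p))"
    using sum.reindex[of ?g ?S F] by (simp add: o_def)
  also have "\<dots> = (\<Sum>U\<in>Pow Y. \<Sum>q\<in>permutations_of_set U \<times> permutations_of_set (Y - U).
      F (?g (U, q)))"
    using assms by (subst sum.Sigma) (auto simp: case_prod_unfold)
  finally show ?thesis by (simp add: sum.cartesian_product case_prod_unfold)
qed

lemma hd_append_single:
  assumes "\<forall>x\<in>set xs. m < x" "m < e"
  shows "m < hd (xs @ [e])"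
  using assms by (cases xs) auto

text \<open>Even with an empty right part, \<open>m\<close> is followed by a greater letter and
  starts no descent, so the descents divide between \<open>us @ [m]\<close> and
  \<open>vs @ [e]\<close>.\<close>

lemma des_sum_insert_min:
  assumes "finite Y" "\<forall>y\<in>Y. m < y" "m < e"
  shows "des_sum t (insert m Y) e = (\<Sum>U\<in>Pow Y. des_sum t U m * des_sum t (Y - U) e)"
proof -
  have m: "m \<notin> Y" using assms(2) by auto
  have *: "t ^ card (descents (us @ m # vs @ [e])) =
      t ^ card (descents (us @ [m])) * t ^ card (descents (vs @ [e]))"
    if "vs \<in> permutations_of_set (Y - U)" for us vs U
  proof -
    have "m < hd (vs @ [e])"
      using assms that by (intro hd_append_single) (auto simp: permutations_of_set_def)
    then show ?thesis
      by (subst card_descents_append, subst card_descents_Cons_less) (auto simp: power_add)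
  qed
  show ?thesis
    unfolding des_sum_def sum_permutations_of_set_insert[OF assms(1) m] sum_product
    by (intro sum.cong refl) (simp add: *)
qed

text \<open>The same cut; the added \<open>t\<close> is the surplus weight of \<open>m\<close> when
  nothing stands to its left.\<close>

lemma gamma_sum_insert_min:
  assumes "finite Y" "\<forall>y\<in>Y. m < y" "m < e"
  shows "gamma_sum t (insert m Y) e =
    (\<Sum>U\<in>Pow Y. (gamma_sum t U m + (if U = {} then t else 0)) * gamma_sum t (Y - U) e)"
proof -
  have m: "m \<notin> Y" using assms(2) by auto
  have *: "gamma_weight t (us @ m # vs @ [e]) =
      (gamma_weight t (us @ [m]) + (if U = {} then t else 0)) * gamma_weight t (vs @ [e])"
    if "us \<in> permutations_of_set U" "U \<subseteq> Y" "vs \<in> permutations_of_set (Y - U)" for us vs U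
  proof -
    have "m < hd (vs @ [e])"
      using assms that by (intro hd_append_single) (auto simp: permutations_of_set_def)
    moreover have "\<forall>x\<in>set us. m < x" using assms that by (auto simp: permutations_of_set_def)
    moreover have "us = [] \<longleftrightarrow> U = {}" using that by (auto simp: permutations_of_set_def)
    ultimately show ?thesis
      by (subst gamma_weight_append) auto
  qed
  have "gamma_sum t (insert m Y) e = (\<Sum>U\<in>Pow Y. \<Sum>us\<in>permutations_of_set U.
     \<Sum>vs\<in>permutations_of_set (Y - U).
      (gamma_weight t (us @ [m]) + (if U = {} then t else 0)) * gamma_weight t (vs @ [e]))"
    unfolding gamma_sum_def sum_permutations_of_set_insert[OF assms(1) m]
    by (intro sum.cong refl) (simp add: *)
  also have "\<dots> = (\<Sum>U\<in>Pow Y. (\<Sum>us\<in>permutations_of_set U.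
      (gamma_weight t (us @ [m]) + (if U = {} then t else 0))) * gamma_sum t (Y - U) e)"
    unfolding gamma_sum_def sum_product by simp
  \<comment> \<open>The surplus enters just once: it occurs only for \<open>U = {}\<close>, whose
    sole arrangement is \<open>[]\<close>.\<close>
  also have "\<dots> =
    (\<Sum>U\<in>Pow Y. (gamma_sum t U m + (if U = {} then t else 0)) * gamma_sum t (Y - U) e)"
    by (intro sum.cong refl) (auto simp: gamma_sum_def)
  finally show ?thesis .
qed

lemma sum_Pow_remove_top:
  assumes "finite Y"
  shows "(\<Sum>U\<in>Pow Y. f U) = (\<Sum>U\<in>Pow Y - {Y}. f U) + f Y"
  using assms by (subst sum.remove[of _ Y]) (auto simp: add.commute)

text \<open>Only for \<open>U = Y\<close> is \<open>m\<close> followed by \<open>e\<close>, which is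
  one more descent; this term is therefore split off with a factor \<open>t\<close>.\<close>

lemma des_sum_insert_above:
  assumes "finite Y" "\<forall>y\<in>Y. m < y" "e < m"
  shows "des_sum t (insert m Y) e =
    (\<Sum>U\<in>Pow Y - {Y}. des_sum t U m * des_sum t (Y - U) e) + t * des_sum t Y m"
proof -
  have m: "m \<notin> Y" using assms(2) by auto
  have *: "t ^ card (descents (us @ m # vs @ [e])) =
      t ^ card (descents (us @ [m])) * t ^ card (descents (vs @ [e]))"
    if "vs \<in> permutations_of_set (Y - U)" "U \<in> Pow Y - {Y}" for us vs U
  proof -
    have "vs \<noteq> []" using that by (auto simp: permutations_of_set_def)
    then have "m < hd (vs @ [e])"
      using assms(2) that by (cases vs) (auto simp: permutations_of_set_def)
    then show ?thesis
      by (subst card_descents_append, subst card_descents_Cons_less) (auto simp: power_add)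
  qed
  have "t ^ card (descents (us @ [m, e])) = t * t ^ card (descents (us @ [m]))" for us
    using assms(3) by (subst card_descents_append) (simp add: card_descents_Cons_Cons)
  then show ?thesis
    unfolding des_sum_def sum_permutations_of_set_insert[OF assms(1) m] sum_product
      sum_Pow_remove_top[OF assms(1)]
    by (intro arg_cong2[where f = "(+)"] sum.cong refl) (simp_all add: * sum_distrib_left)
qed

text \<open>In the split-off case \<open>U = Y\<close> the word ends in \<open>m\<close>,
  \<open>e\<close>, a double descent with any letter before it, so this case contributes only if
  \<open>Y\<close> is empty.\<close>

lemma gamma_sum_insert_above:
  assumes "finite Y" "\<forall>y\<in>Y. m < y" "e < m"
  shows "gamma_sum t (insert m Y) e =
    (\<Sum>U\<in>Pow Y - {Y}. (gamma_sum t U m + (if U = {} then t else 0)) * gamma_sum t (Y - U) e)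
    + (if Y = {} then t else 0)"
proof -
  have m: "m \<notin> Y" using assms(2) by auto
  have *: "gamma_weight t (us @ m # vs @ [e]) =
      (gamma_weight t (us @ [m]) + (if U = {} then t else 0)) * gamma_weight t (vs @ [e])"
    if "us \<in> permutations_of_set U" "U \<in> Pow Y - {Y}" "vs \<in> permutations_of_set (Y - U)" for us vs U
  proof -
    have "vs \<noteq> []" using that by (auto simp: permutations_of_set_def)
    then have "m < hd (vs @ [e])"
      using assms(2) that by (cases vs) (auto simp: permutations_of_set_def)
    moreover have "\<forall>x\<in>set us. m < x" using assms that by (auto simp: permutations_of_set_def)
    moreover have "us = [] \<longleftrightarrow> U = {}" using that by (auto simp: permutations_of_set_def)
    ultimately show ?thesis
      by (subst gamma_weight_append) auto
  qed
  have top: "(\<Sum>us\<in>permutations_of_set Y. gamma_weight t (us @ [m, e])) = (if Y = {} then t else 0)"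
  proof -
    have "gamma_weight t (us @ [m, e]) = (if Y = {} then t else 0)"
      if "us \<in> permutations_of_set Y" for us
      using that assms by (subst gamma_weight_double_descent) (auto simp: permutations_of_set_def)
    then show ?thesis by (auto intro: sum.neutral)
  qed
  have "gamma_sum t (insert m Y) e = (\<Sum>U\<in>Pow Y - {Y}. \<Sum>us\<in>permutations_of_set U.
     \<Sum>vs\<in>permutations_of_set (Y - U).
      (gamma_weight t (us @ [m]) + (if U = {} then t else 0)) * gamma_weight t (vs @ [e]))
      + (if Y = {} then t else 0)"
    unfolding gamma_sum_def sum_permutations_of_set_insert[OF assms(1) m]
      sum_Pow_remove_top[OF assms(1)]
    by (intro arg_cong2[where f = "(+)"] sum.cong refl) (simp_all add: * top)
  also have "(\<Sum>U\<in>Pow Y - {Y}. \<Sum>us\<in>permutations_of_set U. \<Sum>vs\<in>permutations_of_set (Y - U).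
      (gamma_weight t (us @ [m]) + (if U = {} then t else 0)) * gamma_weight t (vs @ [e]))
    = (\<Sum>U\<in>Pow Y - {Y}. (\<Sum>us\<in>permutations_of_set U.
      (gamma_weight t (us @ [m]) + (if U = {} then t else 0))) * gamma_sum t (Y - U) e)"
    unfolding gamma_sum_def sum_product by simp
  also have "\<dots> =
    (\<Sum>U\<in>Pow Y - {Y}. (gamma_sum t U m + (if U = {} then t else 0)) * gamma_sum t (Y - U) e)"
    by (intro sum.cong refl) (auto simp: gamma_sum_def)
  finally show ?thesis .
qed

section \<open>Comparison of the two generating functions\<close>

lemma des_sum_below_cong:
  assumes "\<forall>x\<in>X. m < x" "\<forall>x\<in>X. e < x"
  shows "des_sum t X m = des_sum t X e"
  unfolding des_sum_def using assms
  by (intro sum.cong refl arg_cong[where f = "(^) t"] card_descents_below_cong)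
    (auto simp: permutations_of_set_def)

text \<open>In the recurrence for \<open>gamma_sum\<close> the surplus amounts to
  \<open>t * des_sum t Y e\<close>; in the one for \<open>des_sum\<close> the cut with empty right
  part gives \<open>t * des_sum t Y m\<close>. These agree because \<open>e\<close> and
  \<open>m\<close> both lie below \<open>Y\<close>.\<close>

lemma gamma_sum_eq_des_sum:
  assumes "finite X" "\<forall>x\<in>X. e < x"
  shows "gamma_sum t X e = des_sum t X e"
  using assms
\<comment> \<open>The end letter has to vary because the left parts end in \<open>m\<close>.\<close>
proof (induction "card X" arbitrary: X e rule: less_induct)
  case less
  show ?case
  proof (cases "X = {}")
    case False
    define m where "m = Min X"
    define Y where "Y = X - {m}"
    have "m \<in> X" using False less.prems by (simp add: m_def)
    then have X: "X = insert m Y" "m \<notin> Y" by (auto simp: Y_def)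
    have Y: "finite Y" using less.prems by (auto simp: Y_def)
    have mY: "\<forall>y\<in>Y. m < y"
      using less.prems by (auto simp: Y_def m_def less_le)
    have em: "e < m" using less.prems X by auto
    have card: "card U < card X" if "U \<subseteq> Y" for U
      using that X Y card_mono[of Y U] by simp
    have IHm: "gamma_sum t U m = des_sum t U m" if "U \<subseteq> Y" for U
      using that card Y mY by (intro less.hyps) (auto intro: finite_subset)
    have IHe: "gamma_sum t U e = des_sum t U e" if "U \<subseteq> Y" for U
      using that card Y less.prems X by (intro less.hyps) (auto intro: finite_subset)
    have "gamma_sum t X e = (\<Sum>U\<in>Pow Y - {Y}.
        (des_sum t U m + (if U = {} then t else 0)) * des_sum t (Y - U) e)
        + (if Y = {} then t else 0)"
      unfolding X(1) gamma_sum_insert_above[OF Y mY em]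
      by (intro arg_cong2[where f = "(+)"] sum.cong refl) (simp_all add: IHm IHe)
    also have "\<dots> = (\<Sum>U\<in>Pow Y - {Y}. des_sum t U m * des_sum t (Y - U) e) +
        ((\<Sum>U\<in>Pow Y - {Y}. if U = {} then t * des_sum t Y e else 0) + (if Y = {} then t else 0))"
      unfolding add.assoc[symmetric] sum.distrib[symmetric]
      by (intro arg_cong2[where f = "(+)"] sum.cong refl) (auto simp: distrib_right)
    \<comment> \<open>For nonempty \<open>Y\<close> the surplus is the summand at
      \<open>U = {}\<close>, for empty \<open>Y\<close> it is the separate term.\<close>
    also have "(\<Sum>U\<in>Pow Y - {Y}. if U = {} then t * des_sum t Y e else 0) + (if Y = {} then t else 0)
       = t * des_sum t Y e"
      using Y by (auto simp: sum.delta)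
    also have "des_sum t Y e = des_sum t Y m"
      using mY less.prems X by (intro des_sum_below_cong) auto
    finally show ?thesis unfolding X(1) des_sum_insert_above[OF Y mY em] .
  qed simp
qed

text \<open>Induction by removing the least letter \<open>m\<close> while it lies below
  \<open>e\<close>. The surplus of the empty left part yields the sets \<open>J\<close> that contain
  \<open>m\<close>, the other terms yield those that do not. The left parts lie above their end
  letter \<open>m\<close>, so \<open>gamma_sum_eq_des_sum\<close> settles them.\<close>

lemma gamma_sum_expansion:
  assumes "finite X" "e \<notin> X"
  shows "gamma_sum t X e = (\<Sum>J\<in>Pow {x\<in>X. x < e}. t ^ card J * des_sum t (X - J) e)"
  using assms
proof (induction "card X" arbitrary: X rule: less_induct)
  case less
  show ?case
  proof (cases "\<exists>x\<in>X. x < e")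
    case False
    then have "{x\<in>X. x < e} = {}" by auto
    moreover have "\<forall>x\<in>X. e < x" using False less.prems by (metis linorder_neqE)
    ultimately show ?thesis using less.prems by (simp add: gamma_sum_eq_des_sum del: Collect_empty_eq)
  next
    case True
    define m where "m = Min X"
    define Y where "Y = X - {m}"
    have "m \<in> X" unfolding m_def using True less.prems by (intro Min_in) auto
    then have X: "X = insert m Y" "m \<notin> Y" by (auto simp: Y_def)
    have Y: "finite Y" using less.prems by (auto simp: Y_def)
    have mY: "\<forall>y\<in>Y. m < y"
      using less.prems by (auto simp: Y_def m_def less_le)
    have me: "m < e" using True less.prems(1) unfolding m_def by (metis Min_le le_less_trans)
    let ?L = "\<lambda>Z. {x\<in>Z. x < e}"
    have L: "?L X = insert m (?L Y)" "m \<notin> ?L Y" using X me by auto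
    have card: "card U < card X" if "U \<subseteq> Y" for U
      using that X Y card_mono[of Y U] by simp
    have IH: "gamma_sum t U e = (\<Sum>J\<in>Pow (?L U). t ^ card J * des_sum t (U - J) e)"
      if "U \<subseteq> Y" for U
      using that card Y less.prems X by (intro less.hyps) (auto intro: finite_subset)
    have "gamma_sum t X e = (\<Sum>U\<in>Pow Y. des_sum t U m * gamma_sum t (Y - U) e)
       + (\<Sum>U\<in>Pow Y. if U = {} then t * gamma_sum t Y e else 0)"
      unfolding X(1) gamma_sum_insert_min[OF Y mY me] sum.distrib[symmetric]
      using mY Y by (intro sum.cong refl)
        (auto simp: distrib_right gamma_sum_eq_des_sum finite_subset subset_iff)
    also have "(\<Sum>U\<in>Pow Y. if U = {} then t * gamma_sum t Y e else 0) = t * gamma_sum t Y e"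
      using Y by (simp add: sum.delta)
    \<comment> \<open>Adding \<open>m\<close> to \<open>J\<close> costs a factor \<open>t\<close>
      and leaves the same letters \<open>Y - J\<close>.\<close>
    also have "t * gamma_sum t Y e =
        (\<Sum>J\<in>Pow (?L Y). t ^ card (insert m J) * des_sum t (X - insert m J) e)"
    proof -
      have "t ^ card (insert m J) * des_sum t (X - insert m J) e =
          t * (t ^ card J * des_sum t (Y - J) e)" if "J \<in> Pow (?L Y)" for J
      proof -
        have "m \<notin> J" "finite J" using that L(2) Y by (auto intro: finite_subset)
        moreover have "X - insert m J = Y - J" using X by auto
        ultimately show ?thesis by (simp add: mult_ac)
      qed
      then show ?thesis by (simp add: IH sum_distrib_left)
    qed
    also have "(\<Sum>U\<in>Pow Y. des_sum t U m * gamma_sum t (Y - U) e) =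
        (\<Sum>U\<in>Pow Y. \<Sum>J\<in>Pow (?L (Y - U)). t ^ card J * (des_sum t U m * des_sum t (Y - U - J) e))"
      by (intro sum.cong refl) (simp add: IH sum_distrib_left mult_ac)
    \<comment> \<open>Both sides range over the disjoint pairs of \<open>U \<subseteq> Y\<close> and
      \<open>J \<subseteq> ?L Y\<close>.\<close>
    also have "\<dots> = (\<Sum>J\<in>Pow (?L Y). \<Sum>U\<in>Pow (Y - J).
        t ^ card J * (des_sum t U m * des_sum t (Y - U - J) e))"
    proof -
      have "(\<Sum>U\<in>Pow Y. \<Sum>J\<in>{J. J \<in> Pow (?L Y) \<and> J \<inter> U = {}}. f U J) =
          (\<Sum>J\<in>Pow (?L Y). \<Sum>U\<in>{U. U \<in> Pow Y \<and> J \<inter> U = {}}. f U J)" for f :: "'a set \<Rightarrow> 'a set \<Rightarrow> 'b"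
        using Y by (intro sum.swap_restrict) auto
      moreover have "{J. J \<in> Pow (?L Y) \<and> J \<inter> U = {}} = Pow (?L (Y - U))" for U by auto
      moreover have "{U. U \<in> Pow Y \<and> J \<inter> U = {}} = Pow (Y - J)" for J by auto
      ultimately show ?thesis by simp
    qed
    \<comment> \<open>\<open>m\<close> is still the least letter of \<open>X - J\<close>, so the
      inner sum is the recurrence for \<open>des_sum\<close> read backwards.\<close>
    also have "\<dots> = (\<Sum>J\<in>Pow (?L Y). t ^ card J * des_sum t (X - J) e)"
    proof (intro sum.cong refl)
      fix J assume J: "J \<in> Pow (?L Y)"
      have XJ: "X - J = insert m (Y - J)" using X J by auto
      have sw: "Y - U - J = Y - J - U" for U by auto
      show "(\<Sum>U\<in>Pow (Y - J). t ^ card J * (des_sum t U m * des_sum t (Y - U - J) e)) =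
          t ^ card J * des_sum t (X - J) e"
        unfolding XJ sw using Y mY me
        by (subst des_sum_insert_min) (auto simp: sum_distrib_left)
    qed
    also have "(\<Sum>J\<in>Pow (?L Y). t ^ card J * des_sum t (X - J) e) +
        (\<Sum>J\<in>Pow (?L Y). t ^ card (insert m J) * des_sum t (X - insert m J) e) =
        (\<Sum>J\<in>Pow (?L X). t ^ card J * des_sum t (X - J) e)"
    proof -
      have "inj_on (insert m) (Pow (?L Y))" using L(2) by (auto simp: inj_on_def insert_ident)
      moreover have "Pow (?L Y) \<inter> insert m ` Pow (?L Y) = {}" using L(2) by auto
      ultimately show ?thesis
        unfolding L(1) Pow_insert using Y
        by (subst sum.union_disjoint) (auto simp: sum.reindex)
    qed
    finally show ?thesis .
  qed
qed

section \<open>Summation over all choices of signs\<close>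

text \<open>
  A signed letter is a pair of a sign, \<open>0\<close> for negative and \<open>1\<close> for positive, and an absolute
  value, in lexicographic order; \<open>(1, 0)\<close> separates the negative letters from the positive ones.
\<close>

definition signed_words :: "nat set \<Rightarrow> (nat \<times> nat) list set" where
  "signed_words K =
     {xs. distinct (map snd xs) \<and> snd ` set xs = K \<and> fst ` set xs \<subseteq> {0, 1}}"

text \<open>\<open>P\<close> holds the absolute values that get the negative sign.\<close>

definition signing :: "nat set \<Rightarrow> nat set \<Rightarrow> (nat \<times> nat) set" where
  "signing K P = Pair 0 ` P \<union> Pair 1 ` (K - P)"

lemma finite_signing: "finite K \<Longrightarrow> P \<subseteq> K \<Longrightarrow> finite (signing K P)"
  by (auto simp: signing_def intro: finite_subset)

text \<open>Absolute values do not repeat, so each has exactly one sign and \<open>P\<close> is read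
  off as the set of values with sign \<open>0\<close>.\<close>

lemma signed_words_eq_Union:
  "signed_words K = (\<Union>P\<in>Pow K. permutations_of_set (signing K P))"
proof (intro equalityI subsetI)
  fix xs assume "xs \<in> signed_words K"
  then have xs: "distinct xs" "inj_on snd (set xs)" "snd ` set xs = K" "fst ` set xs \<subseteq> {0, 1}"
    by (auto simp: signed_words_def distinct_map)
  define P where "P = {k. (0, k) \<in> set xs}"
  have P: "P \<subseteq> K" using xs(3) by (force simp: P_def)
  have "set xs = signing K P"
  proof (intro equalityI subsetI)
    fix x assume x: "x \<in> set xs"
    obtain a b where ab: "x = (a, b)" by (cases x)
    have b: "b \<in> K" using x ab xs(3) by force
    have "a = 0 \<or> a = 1" using x ab xs(4) by force
    then show "x \<in> signing K P"
    proof
      assume a: "a = 1"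
      have "(0, b) \<notin> set xs"
      proof
        assume "(0, b) \<in> set xs"
        with x ab have "(0, b) = (a, b)" by (intro inj_onD[OF xs(2)]) auto
        with a show False by simp
      qed
      then show ?thesis using a ab b by (auto simp: signing_def P_def)
    qed (use x ab in \<open>auto simp: signing_def P_def\<close>)
  next
    fix x assume x: "x \<in> signing K P"
    show "x \<in> set xs"
    proof (cases "x \<in> Pair 0 ` P")
      case True
      then show ?thesis by (auto simp: P_def)
    next
      case False
      then obtain k where k: "x = (1, k)" "k \<in> K" "k \<notin> P" using x by (auto simp: signing_def)
      then obtain a where a: "(a, k) \<in> set xs" using xs(3) by force
      then have "a = 0 \<or> a = 1" using xs(4) by force
      then show ?thesis using a k by (auto simp: P_def)
    qed
  qed
  then show "xs \<in> (\<Union>P\<in>Pow K. permutations_of_set (signing K P))"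
    using xs(1) P by (auto simp: permutations_of_set_def)
next
  fix xs assume "xs \<in> (\<Union>P\<in>Pow K. permutations_of_set (signing K P))"
  then obtain P where P: "P \<subseteq> K" "set xs = signing K P" "distinct xs"
    by (auto simp: permutations_of_set_def)
  have "inj_on snd (signing K P)" by (auto simp: signing_def inj_on_def)
  moreover have "snd ` signing K P = K" using P(1) by (force simp: signing_def image_Un image_image)
  moreover have "fst ` signing K P \<subseteq> {0, 1}" by (auto simp: signing_def)
  ultimately show "xs \<in> signed_words K" using P by (simp add: signed_words_def distinct_map)
qed

lemma sum_signed_words:
  assumes "finite K"
  shows "(\<Sum>xs\<in>signed_words K. F xs) =
    (\<Sum>P\<in>Pow K. \<Sum>xs\<in>permutations_of_set (signing K P). F xs)"
  unfolding signed_words_eq_Union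
proof (rule sum.UNION_disjoint)
  have "P = {k. (0, k) \<in> signing K P}" for P by (auto simp: signing_def)
  then have inj: "P = Q" if "signing K P = signing K Q" for P Q using that by metis
  show "\<forall>P\<in>Pow K. \<forall>Q\<in>Pow K. P \<noteq> Q \<longrightarrow>
      permutations_of_set (signing K P) \<inter> permutations_of_set (signing K Q) = {}"
  proof (intro ballI impI)
    fix P Q :: "nat set" assume "P \<noteq> Q"
    then have "signing K P \<noteq> signing K Q" using inj by blast
    then show "permutations_of_set (signing K P) \<inter> permutations_of_set (signing K Q) = {}"
      by (auto simp: permutations_of_set_def)
  qed
qed (use assms in auto)

definition signed_des_sum :: "'b::comm_semiring_1 \<Rightarrow> nat set \<Rightarrow> 'b" where
  "signed_des_sum t K = (\<Sum>xs\<in>signed_words K. t ^ card (descents (xs @ [(1, 0)])))"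

definition signed_gamma_sum :: "'b::comm_semiring_1 \<Rightarrow> nat set \<Rightarrow> 'b" where
  "signed_gamma_sum t K = (\<Sum>xs\<in>signed_words K. gamma_weight t (xs @ [(1, 0)]))"

lemma signed_des_sum_eq:
  "finite K \<Longrightarrow> signed_des_sum t K = (\<Sum>P\<in>Pow K. des_sum t (signing K P) (1, 0))"
  by (simp add: signed_des_sum_def sum_signed_words des_sum_def)

text \<open>The letters below \<open>(1, 0)\<close> are the negative ones, so the sets to be removed
  correspond to the \<open>J \<subseteq> P\<close>. For fixed \<open>J\<close>, the set
  \<open>P - J\<close> runs through all choices of signs on \<open>K - J\<close>, which restores a
  full signed sum. The assumption \<open>0 \<notin> K\<close> keeps the end letter out of the
  words.\<close>

lemma signed_gamma_sum_expansion:
  assumes "finite K" "0 \<notin> K"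
  shows "signed_gamma_sum t K = (\<Sum>J\<in>Pow K. t ^ card J * signed_des_sum t (K - J))"
proof -
  have "signed_gamma_sum t K = (\<Sum>P\<in>Pow K. gamma_sum t (signing K P) (1, 0))"
    using assms by (simp add: signed_gamma_sum_def sum_signed_words gamma_sum_def)
  also have "\<dots> = (\<Sum>P\<in>Pow K. \<Sum>J\<in>Pow P.
      t ^ card J * des_sum t (signing (K - J) (P - J)) (1, 0))"
  proof (intro sum.cong refl)
    fix P assume P: "P \<in> Pow K"
    have neg: "{x \<in> signing K P. x < (1, 0)} = Pair 0 ` P"
      using P assms by (auto simp: signing_def less_prod_def')
    have "gamma_sum t (signing K P) (1, 0) = (\<Sum>J\<in>Pow (Pair 0 ` P).
        t ^ card J * des_sum t (signing K P - J) (1, 0))"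
      using gamma_sum_expansion[of "signing K P" "(1, 0)" t] P assms unfolding neg
      by (auto simp: finite_signing) (auto simp: signing_def)
    also have "Pow (Pair 0 ` P) = image (Pair 0) ` Pow P"
      by (simp add: image_Pow_surj)
    also have "(\<Sum>J\<in>image (Pair 0) ` Pow P. t ^ card J * des_sum t (signing K P - J) (1, 0)) =
        (\<Sum>J\<in>Pow P. t ^ card J * des_sum t (signing K P - Pair 0 ` J) (1, 0))"
      by (subst sum.reindex) (auto simp: card_image inj_on_def inj_image_eq_iff intro!: sum.cong)
    also have "\<dots> = (\<Sum>J\<in>Pow P. t ^ card J * des_sum t (signing (K - J) (P - J)) (1, 0))"
    proof (intro sum.cong refl)
      fix J assume "J \<in> Pow P"
      then have "signing K P - Pair 0 ` J = signing (K - J) (P - J)"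
        using P by (auto simp: signing_def)
      then show "t ^ card J * des_sum t (signing K P - Pair 0 ` J) (1, 0) =
        t ^ card J * des_sum t (signing (K - J) (P - J)) (1, 0)" by simp
    qed
    finally show "gamma_sum t (signing K P) (1, 0) =
      (\<Sum>J\<in>Pow P. t ^ card J * des_sum t (signing (K - J) (P - J)) (1, 0))" .
  qed
  also have "\<dots> = (\<Sum>J\<in>Pow K. \<Sum>P\<in>{P. P \<in> Pow K \<and> J \<subseteq> P}.
      t ^ card J * des_sum t (signing (K - J) (P - J)) (1, 0))"
  proof -
    have "(\<Sum>P\<in>Pow K. \<Sum>J\<in>{J. J \<in> Pow K \<and> J \<subseteq> P}. f P J) =
        (\<Sum>J\<in>Pow K. \<Sum>P\<in>{P. P \<in> Pow K \<and> J \<subseteq> P}. f P J)" for f :: "nat set \<Rightarrow> nat set \<Rightarrow> 'a"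
      using assms by (intro sum.swap_restrict) auto
    moreover have "{J. J \<in> Pow K \<and> J \<subseteq> P} = Pow P" if "P \<in> Pow K" for P
      using that by auto
    ultimately show ?thesis by simp
  qed
  also have "\<dots> = (\<Sum>J\<in>Pow K. t ^ card J * signed_des_sum t (K - J))"
  proof (intro sum.cong refl)
    fix J assume J: "J \<in> Pow K"
    have "(\<Sum>P\<in>{P. P \<in> Pow K \<and> J \<subseteq> P}. t ^ card J * des_sum t (signing (K - J) (P - J)) (1, 0))
       = (\<Sum>Q\<in>Pow (K - J). t ^ card J * des_sum t (signing (K - J) Q) (1, 0))"
      using J by (intro sum.reindex_bij_witness[of _ "\<lambda>Q. Q \<union> J" "\<lambda>P. P - J"]) auto
    then show "(\<Sum>P\<in>{P. P \<in> Pow K \<and> J \<subseteq> P}.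
        t ^ card J * des_sum t (signing (K - J) (P - J)) (1, 0)) =
      t ^ card J * signed_des_sum t (K - J)"
      using assms by (simp add: signed_des_sum_eq sum_distrib_left)
  qed
  finally show ?thesis .
qed

section \<open>Relabelling by order-preserving maps\<close>

lemma des_sum_image:
  assumes "strict_mono_on A f" "insert e X \<subseteq> A"
  shows "des_sum t (f ` X) (f e) = des_sum t X e"
proof -
  have inj: "inj_on f X"
    using strict_mono_on_imp_inj_on[OF assms(1)] assms(2) by (auto intro: inj_on_subset)
  have "descents (map f xs @ [f e]) = descents (xs @ [e])" if "xs \<in> permutations_of_set X" for xs
    using descents_map[OF assms(1), of "xs @ [e]"] assms(2) that
    by (auto simp: permutations_of_set_def)
  moreover have "inj_on (map f) (permutations_of_set X)"
  proof (rule inj_onI)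
    fix xs ys assume "xs \<in> permutations_of_set X" "ys \<in> permutations_of_set X"
    then have "set xs \<union> set ys = X" by (simp add: permutations_of_setD(1))
    with inj show "xs = ys" if "map f xs = map f ys" using that by (metis map_inj_on)
  qed
  ultimately show ?thesis
    unfolding des_sum_def permutations_of_set_image_inj[OF inj]
    by (simp add: sum.reindex)
qed

text \<open>The map acts on absolute values only, which preserves the lexicographic order;
  \<open>f 0 = 0\<close> fixes the end letter \<open>(1, 0)\<close>.\<close>

lemma signed_des_sum_image:
  assumes "finite K" "0 \<notin> K" "strict_mono_on (insert 0 K) f" "f 0 = 0"
  shows "signed_des_sum t (f ` K) = signed_des_sum t K"
proof -
  have inj: "inj_on f K"
    using strict_mono_on_imp_inj_on[OF assms(3)] by (auto intro: inj_on_subset)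
  have mono: "strict_mono_on (UNIV \<times> insert 0 K) (map_prod id f)"
    using assms(3) by (auto simp: strict_mono_on_def less_prod_def')
  have "signed_des_sum t (f ` K) = (\<Sum>P\<in>Pow K. des_sum t (signing (f ` K) (f ` P)) (1, 0))"
    using assms(1) inj
    by (simp add: signed_des_sum_eq image_Pow_surj[OF refl, symmetric] sum.reindex inj_on_image_Pow)
  also have "\<dots> = (\<Sum>P\<in>Pow K. des_sum t (signing K P) (1, 0))"
  proof (intro sum.cong refl)
    fix P assume P: "P \<in> Pow K"
    have "f ` K - f ` P = f ` (K - P)" using inj P by (simp add: inj_on_image_set_diff[of f K])
    then have "signing (f ` K) (f ` P) = map_prod id f ` signing K P"
      by (simp add: signing_def image_Un image_image)
    moreover have "insert (1, 0) (signing K P) \<subseteq> UNIV \<times> insert 0 K"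
      using P by (auto simp: signing_def)
    ultimately show "des_sum t (signing (f ` K) (f ` P)) (1, 0) = des_sum t (signing K P) (1, 0)"
      using des_sum_image[OF mono, of "(1, 0)" "signing K P" t] assms(4) by simp
  qed
  finally show ?thesis using assms(1) by (simp add: signed_des_sum_eq)
qed

lemma signed_des_sum_card:
  assumes "finite K" "0 \<notin> K"
  shows "signed_des_sum t K = signed_des_sum t {1..card K}"
proof -
  \<comment> \<open>The rank of \<open>x\<close> in \<open>K\<close>, which maps \<open>K\<close>
    increasingly onto \<open>{1..card K}\<close>; \<open>0\<close> has rank \<open>0\<close> because
    \<open>0 \<notin> K\<close>.\<close>
  define f where "f x = card {k \<in> K. k \<le> x}" for x
  have f0: "f 0 = 0" using assms(2) by (auto simp: f_def card_eq_0_iff)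
  have mono: "strict_mono_on (insert 0 K) f"
  proof (rule strict_mono_onI)
    fix x y assume "x \<in> insert 0 K" "y \<in> insert 0 K" "x < y"
    then have "y \<in> K" by auto
    have "{k \<in> K. k \<le> x} \<subset> {k \<in> K. k \<le> y}" using \<open>y \<in> K\<close> \<open>x < y\<close> by force
    then show "f x < f y" unfolding f_def using assms(1) by (intro psubset_card_mono) auto
  qed
  have inj: "inj_on f K"
    using strict_mono_on_imp_inj_on[OF mono] by (auto intro: inj_on_subset)
  have "f x \<in> {1..card K}" if "x \<in> K" for x
  proof -
    have "f 0 < f x" using mono that assms(2) by (intro strict_mono_onD[OF mono]) (auto intro: gr0I)
    moreover have "f x \<le> card K" unfolding f_def using assms(1) by (intro card_mono) auto
    ultimately show ?thesis by simp
  qed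
  then have "f ` K = {1..card K}"
    using inj by (intro card_subset_eq) (auto simp: card_image)
  then show ?thesis using signed_des_sum_image[OF assms mono f0, of t] by simp
qed

section \<open>Coloured permutations as signed words\<close>

lemma map_mem_signed_words_iff:
  "map g [1..<Suc n] \<in> signed_words {1..n} \<longleftrightarrow>
     bij_betw (\<lambda>k. snd (g k)) {1..n} {1..n} \<and> (\<forall>k\<in>{1..n}. fst (g k) \<in> {0, 1})"
proof -
  have "set [1..<Suc n] = {1..n}" by auto
  moreover have "inj_on (\<lambda>k. snd (g k)) A \<longleftrightarrow> inj_on g A \<and> inj_on snd (g ` A)" for A
    by (auto simp: inj_on_def)
  ultimately show ?thesis
    unfolding signed_words_def bij_betw_def
    by (simp add: distinct_map image_image o_def image_subset_iff del: upt_Suc set_upt)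
qed

lemma signed_wordsE:
  assumes "xs \<in> signed_words {1..n}"
  obtains g where "xs = map g [1..<Suc n]" "bij_betw (\<lambda>k. snd (g k)) {1..n} {1..n}"
    "\<And>k. k \<in> {1..n} \<Longrightarrow> fst (g k) \<in> {0, 1}"
proof -
  have "length xs = card (snd ` set xs)"
    using assms distinct_card[of "map snd xs"] by (simp add: signed_words_def)
  then have "length xs = n" using assms by (simp add: signed_words_def)
  \<comment> \<open>Positions are counted from 1, list indices from 0.\<close>
  then have "xs = map (\<lambda>k. xs ! (k - 1)) [1..<Suc n]"
    by (intro nth_equalityI) (auto simp del: upt_Suc)
  with assms that map_mem_signed_words_iff show ?thesis by metis
qed

lemma Suc_descents_map:
  "Suc ` descents (map g [1..<Suc n] @ [e]) =
     {k \<in> {1..n}. g k > (if k < n then g (k + 1) else e)}"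
proof -
  have "k \<in> Suc ` descents (map g [1..<Suc n] @ [e]) \<longleftrightarrow>
      k \<in> {1..n} \<and> g k > (if k < n then g (k + 1) else e)" for k
    by (cases k) (auto simp: descents_def nth_append simp del: upt_Suc)
  then show ?thesis by blast
qed

lemma signed_words_eq_colored_perms:
  "bij_betw (\<lambda>(\<sigma>, \<epsilon>). map (\<lambda>k. (\<epsilon> k, \<sigma> k)) [1..<Suc n]) (colored_perms n) (signed_words {1..n})"
  unfolding bij_betw_def
proof
  show "inj_on (\<lambda>(\<sigma>, \<epsilon>). map (\<lambda>k. (\<epsilon> k, \<sigma> k)) [1..<Suc n]) (colored_perms n)"
  proof (rule inj_onI, clarify)
    fix \<sigma> \<epsilon> \<sigma>' \<epsilon>' assume A: "(\<sigma>, \<epsilon>) \<in> colored_perms n" "(\<sigma>', \<epsilon>') \<in> colored_perms n"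
      and eq: "map (\<lambda>k. (\<epsilon> k, \<sigma> k)) [1..<Suc n] = map (\<lambda>k. (\<epsilon>' k, \<sigma>' k)) [1..<Suc n]"
    have "\<epsilon> k = \<epsilon>' k \<and> \<sigma> k = \<sigma>' k" for k
    proof (cases "k \<in> {1..n}")
      case True
      then show ?thesis using eq by (auto simp del: upt_Suc)
    next
      case False
      then show ?thesis using A by (auto simp: colored_perms_def permutes_def)
    qed
    then show "\<sigma> = \<sigma>' \<and> \<epsilon> = \<epsilon>'" by auto
  qed
  show "(\<lambda>(\<sigma>, \<epsilon>). map (\<lambda>k. (\<epsilon> k, \<sigma> k)) [1..<Suc n]) ` colored_perms n = signed_words {1..n}"
  proof (intro equalityI subsetI)
    fix xs assume "xs \<in> signed_words {1..n}"
    then obtain g where g: "xs = map g [1..<Suc n]" "bij_betw (\<lambda>k. snd (g k)) {1..n} {1..n}"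
      "\<And>k. k \<in> {1..n} \<Longrightarrow> fst (g k) \<in> {0, 1}" by (rule signed_wordsE) blast
    \<comment> \<open>Outside \<open>{1..n}\<close> the values are forced by the normalisation in
      \<open>colored_perms\<close>.\<close>
    define \<sigma> where "\<sigma> k = (if k \<in> {1..n} then snd (g k) else k)" for k
    define \<epsilon> where "\<epsilon> k = (if k \<in> {1..n} then fst (g k) else 0)" for k
    have "bij_betw \<sigma> {1..n} {1..n}"
      using g(2) by (subst bij_betw_cong[of _ _ "\<lambda>k. snd (g k)"]) (auto simp: \<sigma>_def)
    then have "\<sigma> permutes {1..n}" by (rule bij_imp_permutes) (auto simp: \<sigma>_def)
    then have "(\<sigma>, \<epsilon>) \<in> colored_perms n" using g(3) by (auto simp: colored_perms_def \<epsilon>_def)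
    moreover have "xs = map (\<lambda>k. (\<epsilon> k, \<sigma> k)) [1..<Suc n]"
      unfolding g(1) by (intro map_cong refl) (auto simp: \<sigma>_def \<epsilon>_def)
    ultimately show "xs \<in> (\<lambda>(\<sigma>, \<epsilon>). map (\<lambda>k. (\<epsilon> k, \<sigma> k)) [1..<Suc n]) ` colored_perms n"
      by (intro rev_image_eqI[of "(\<sigma>, \<epsilon>)"]) auto
  next
    fix xs assume "xs \<in> (\<lambda>(\<sigma>, \<epsilon>). map (\<lambda>k. (\<epsilon> k, \<sigma> k)) [1..<Suc n]) ` colored_perms n"
    then obtain \<sigma> \<epsilon> where A: "(\<sigma>, \<epsilon>) \<in> colored_perms n"
      and xs: "xs = map (\<lambda>k. (\<epsilon> k, \<sigma> k)) [1..<Suc n]" by (auto simp del: upt_Suc)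
    show "xs \<in> signed_words {1..n}"
      unfolding xs map_mem_signed_words_iff
      using A permutes_imp_bij[of \<sigma> "{1..n}"] by (auto simp: colored_perms_def)
  qed
qed

text \<open>With the colour as first component, the lexicographic order is the descent condition of
  \<open>colored_des\<close>; only the boundary needs a separate check.\<close>

lemma B_poly_eq_signed_des_sum: "B_poly n = signed_des_sum [:0, 1:] {1..n}"
proof -
  have "colored_des n (\<sigma>, \<epsilon>) =
      card (descents (map (\<lambda>k. (\<epsilon> k, \<sigma> k)) [1..<Suc n] @ [(1, 0)]))"
    if A: "(\<sigma>, \<epsilon>) \<in> colored_perms n" for \<sigma> \<epsilon>
  proof -
    have range: "\<epsilon> k \<in> {0, 1}" "\<sigma> k \<in> {1..n}" if "k \<in> {1..n}" for k
      using A that by (auto simp: colored_perms_def permutes_in_image simp del: atLeastAtMost_iff)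
    have end_values: "\<epsilon> (n + 1) = 0" "\<sigma> (n + 1) = n + 1"
      using A by (auto simp: colored_perms_def permutes_def)
    have "{k \<in> {1..n}. \<epsilon> k > \<epsilon> (k + 1) \<or> (\<epsilon> k = \<epsilon> (k + 1) \<and> \<sigma> k > \<sigma> (k + 1))} =
        Suc ` descents (map (\<lambda>k. (\<epsilon> k, \<sigma> k)) [1..<Suc n] @ [(1, 0)])"
      unfolding Suc_descents_map
    proof (intro Collect_cong conj_cong refl)
      fix k assume k: "k \<in> {1..n}"
      show "(\<epsilon> k > \<epsilon> (k + 1) \<or> \<epsilon> k = \<epsilon> (k + 1) \<and> \<sigma> k > \<sigma> (k + 1)) \<longleftrightarrow>
          (\<epsilon> k, \<sigma> k) > (if k < n then (\<epsilon> (k + 1), \<sigma> (k + 1)) else (1, 0))"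
      proof (cases "k < n")
        case True
        then show ?thesis by (auto simp: less_prod_def')
      next
        case False
        then have [simp]: "k = n" using k by simp
        \<comment> \<open>The boundary letter is \<open>(0, n + 1)\<close> for
          \<open>colored_des\<close> and \<open>(1, 0)\<close> here; since
          \<open>0 < \<sigma> n \<le> n\<close>, either one gives a descent exactly when
          \<open>\<epsilon> n = 1\<close>.\<close>
        have "\<epsilon> n = 0 \<or> \<epsilon> n = 1" "0 < \<sigma> n" "\<sigma> n \<le> n" using range[OF k] by simp_all
        then show ?thesis using end_values by (elim disjE) simp_all
      qed
    qed
    then show ?thesis unfolding colored_des_def by (simp add: card_image del: upt_Suc)
  qed
  then show ?thesis
    unfolding B_poly_def signed_des_sum_def sum.reindex_bij_betw[OF signed_words_eq_colored_perms, symmetric]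
    by (intro sum.cong refl) auto
qed

lemma sum_by_value:
  fixes h :: "'i \<Rightarrow> 'b::comm_semiring_1"
  assumes "finite S" "finite T" "f ` S \<subseteq> T"
  shows "(\<Sum>x\<in>S. h (f x)) = (\<Sum>i\<in>T. of_nat (card {x \<in> S. f x = i}) * h i)"
proof -
  have "(\<Sum>x\<in>S. h (f x)) = (\<Sum>i\<in>T. \<Sum>x\<in>{x \<in> S. f x = i}. h (f x))"
    using assms by (rule sum.group[symmetric])
  also have "\<dots> = (\<Sum>i\<in>T. of_nat (card {x \<in> S. f x = i}) * h i)"
    by (intro sum.cong refl) simp
  finally show ?thesis .
qed

lemma sum_Pow_card:
  fixes f :: "nat \<Rightarrow> 'b::comm_semiring_1"
  assumes "finite K"
  shows "(\<Sum>J\<in>Pow K. f (card J)) = (\<Sum>i\<le>card K. of_nat (card K choose i) * f i)"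
proof -
  have "card ` Pow K \<subseteq> {..card K}" using assms by (auto intro: card_mono)
  then show ?thesis
    using assms by (subst sum_by_value[of _ "{..card K}"]) (simp_all add: n_subsets Pow_def)
qed

text \<open>By \<open>signed_des_sum_card\<close> a term of the expansion depends only on
  \<open>card J\<close>, so the sets of equal size combine into a binomial coefficient; reversing
  the summation gives \<open>B_tilde\<close>.\<close>

lemma B_tilde_eq_signed_gamma_sum: "B_tilde n = signed_gamma_sum [:0, 1:] {1..n}"
proof -
  have "signed_gamma_sum [:0, 1 :: real:] {1..n} =
      (\<Sum>J\<in>Pow {1..n}. [:0, 1:] ^ card J * B_poly (n - card J))"
  proof -
    have "signed_des_sum [:0, 1 :: real:] ({1..n} - J) = B_poly (n - card J)" if "J \<in> Pow {1..n}" for J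
      unfolding B_poly_eq_signed_des_sum using that
      by (subst signed_des_sum_card) (auto simp: card_Diff_subset finite_subset)
    then show ?thesis by (subst signed_gamma_sum_expansion) auto
  qed
  also have "\<dots> = (\<Sum>i\<le>n. of_nat (n choose i) * ([:0, 1:] ^ i * B_poly (n - i)))"
    by (subst sum_Pow_card) auto
  also have "\<dots> = (\<Sum>m\<le>n. of_nat (n choose m) * ([:0, 1:] ^ (n - m) * B_poly m))"
    by (intro sum.reindex_bij_witness[of _ "\<lambda>i. n - i" "\<lambda>i. n - i"])
      (auto simp: binomial_symmetric[symmetric])
  finally show ?thesis by (simp add: B_tilde_def mult_ac)
qed

section \<open>Signed permutations and their descent sets\<close>

text \<open>Zero gets the sign \<open>1\<close> so that the boundary value
  \<open>w (n + 1) = 0\<close> becomes the end letter \<open>(1, 0)\<close>.\<close>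

definition signed_letter :: "int \<Rightarrow> nat \<times> nat" where
  "signed_letter x = (of_bool (x \<ge> 0), nat \<bar>x\<bar>)"

lemma signed_words_eq_signed_perms:
  "bij_betw (\<lambda>w. map (\<lambda>k. signed_letter (w k)) [1..<Suc n]) (signed_perms n) (signed_words {1..n})"
  unfolding bij_betw_def
proof
  have inj: "x = y" if "signed_letter x = signed_letter y" for x y
    using that by (cases "x \<ge> 0"; cases "y \<ge> 0") (auto simp: signed_letter_def)
  show "inj_on (\<lambda>w. map (\<lambda>k. signed_letter (w k)) [1..<Suc n]) (signed_perms n)"
  proof (rule inj_onI, rule ext)
    fix w w' k assume A: "w \<in> signed_perms n" "w' \<in> signed_perms n"
      and eq: "map (\<lambda>k. signed_letter (w k)) [1..<Suc n] = map (\<lambda>k. signed_letter (w' k)) [1..<Suc n]"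
    show "w k = w' k"
    proof (cases "k \<in> {1..n}")
      case True
      then show ?thesis using eq inj by (auto simp del: upt_Suc)
    next
      case False
      then show ?thesis using A by (auto simp: signed_perms_def)
    qed
  qed
  show "(\<lambda>w. map (\<lambda>k. signed_letter (w k)) [1..<Suc n]) ` signed_perms n = signed_words {1..n}"
  proof (intro equalityI subsetI)
    fix xs assume "xs \<in> signed_words {1..n}"
    then obtain g where g: "xs = map g [1..<Suc n]" "bij_betw (\<lambda>k. snd (g k)) {1..n} {1..n}"
      "\<And>k. k \<in> {1..n} \<Longrightarrow> fst (g k) \<in> {0, 1}" by (rule signed_wordsE) blast
    define w where "w k = (if k \<in> {1..n} then if fst (g k) = 0 then - int (snd (g k))
      else int (snd (g k)) else 0)" for k
    have "bij_betw (\<lambda>k. nat \<bar>w k\<bar>) {1..n} {1..n}"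
      using g(2) by (subst bij_betw_cong[of _ _ "\<lambda>k. snd (g k)"]) (auto simp: w_def)
    then have "w \<in> signed_perms n" by (auto simp: signed_perms_def w_def)
    moreover have "xs = map (\<lambda>k. signed_letter (w k)) [1..<Suc n]"
      unfolding g(1)
    proof (intro map_cong refl)
      fix k assume "k \<in> set [1..<Suc n]"
      then have k: "k \<in> {1..n}" by auto
      \<comment> \<open>The absolute value is nonzero, so the sign can be read back from the
        integer.\<close>
      then have "snd (g k) \<in> {1..n}" using g(2) by (meson bij_betwE)
      then show "g k = signed_letter (w k)"
        using k g(3)[OF k] by (cases "g k") (auto simp: w_def signed_letter_def)
    qed
    ultimately show "xs \<in> (\<lambda>w. map (\<lambda>k. signed_letter (w k)) [1..<Suc n]) ` signed_perms n"
      by auto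
  next
    fix xs assume "xs \<in> (\<lambda>w. map (\<lambda>k. signed_letter (w k)) [1..<Suc n]) ` signed_perms n"
    then obtain w where w: "w \<in> signed_perms n"
      and xs: "xs = map (\<lambda>k. signed_letter (w k)) [1..<Suc n]" by blast
    show "xs \<in> signed_words {1..n}"
      unfolding xs map_mem_signed_words_iff
      using w by (auto simp: signed_perms_def signed_letter_def)
  qed
qed

lemma Des_B_eq_descents:
  assumes "w \<in> signed_perms n"
  shows "Des_B n w = Suc ` descents (map (\<lambda>k. signed_letter (w k)) [1..<Suc n] @ [(1, 0)])"
proof -
  have nz: "w k \<noteq> 0" if "k \<in> {1..n}" for k
  proof -
    have "nat \<bar>w k\<bar> \<in> {1..n}" using assms that by (auto simp: signed_perms_def dest: bij_betwE)
    then show ?thesis by auto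
  qed
  have end0: "w (n + 1) = 0" using assms by (auto simp: signed_perms_def)
  \<comment> \<open>The case \<open>x = 0\<close> must be excluded: \<open>(1, 0)\<close> exceeds
    the negative letters, while \<open>0\<close> starts no descent in the sense of
    \<open>Des_B\<close>.\<close>
  have less: "signed_letter y < signed_letter x \<longleftrightarrow>
      (x > 0 \<and> x > y) \<or> (x < 0 \<and> y < 0 \<and> \<bar>x\<bar> > \<bar>y\<bar>)" if "x \<noteq> 0" for x y
    using that by (auto simp: signed_letter_def less_prod_def')
  have succ: "(if k < n then signed_letter (w (k + 1)) else (1, 0)) = signed_letter (w (k + 1))"
    if "k \<in> {1..n}" for k
  proof (cases "k < n")
    case False
    then have "k = n" using that by simp
    then show ?thesis using end0 by (simp add: signed_letter_def)
  qed simp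
  show ?thesis
    unfolding Suc_descents_map Des_B_def
  proof (intro Collect_cong conj_cong refl)
    fix k assume k: "k \<in> {1..n}"
    show "(w k > 0 \<and> w k > w (k + 1) \<or> w k < 0 \<and> w (k + 1) < 0 \<and> \<bar>w k\<bar> > \<bar>w (k + 1)\<bar>) \<longleftrightarrow>
        signed_letter (w k) > (if k < n then signed_letter (w (k + 1)) else (1, 0))"
      unfolding succ[OF k] less[OF nz[OF k]] by (rule refl)
  qed
qed

lemma no_two_consecutive_Suc: "no_two_consecutive (Suc ` S) \<longleftrightarrow> no_two_consecutive S"
  by (auto simp: no_two_consecutive_def)

text \<open>The word has \<open>n + 1\<close> letters including the end letter, so a descent at its
  end is a descent at position \<open>n\<close>, and the closed form specialises to the exponents of
  the theorem.\<close>

lemma gamma_weight_signed_perm: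
  fixes t :: "'b::comm_semiring_1"
  assumes "w \<in> signed_perms n" "n > 0"
  defines "xs \<equiv> map (\<lambda>k. signed_letter (w k)) [1..<Suc n] @ [(1, 0)]"
  shows "gamma_weight t xs =
      (if no_two_consecutive (Des_B n w) then
         t ^ card (Des_B n w) *
         (1 + t) ^ (n + of_bool (n \<in> Des_B n w) - 2 * card (Des_B n w))
       else 0)"
    and "no_two_consecutive (Des_B n w) \<Longrightarrow>
      2 * card (Des_B n w) \<le> n + of_bool (n \<in> Des_B n w)"
proof -
  have D: "Des_B n w = Suc ` descents xs" unfolding xs_def by (rule Des_B_eq_descents) fact
  have len: "length xs = Suc n" by (simp add: xs_def del: upt_Suc)
  \<comment> \<open>The index \<open>length xs - 2\<close> is \<open>n - 1\<close>, whose successor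
    is \<open>n\<close> because \<open>n > 0\<close>.\<close>
  have last: "descent_at_end xs \<longleftrightarrow> n \<in> Des_B n w"
    unfolding descent_at_end_def D len using assms(2) by (cases n) auto
  have card: "card (Des_B n w) = card (descents xs)" by (simp add: D card_image)
  have no2: "no_two_consecutive (Des_B n w) \<longleftrightarrow> no_two_consecutive (descents xs)"
    by (simp add: D no_two_consecutive_Suc)
  have ne: "xs \<noteq> []" by (simp add: xs_def)
  show "gamma_weight t xs =
      (if no_two_consecutive (Des_B n w) then
         t ^ card (Des_B n w) *
         (1 + t) ^ (n + of_bool (n \<in> Des_B n w) - 2 * card (Des_B n w))
       else 0)"
    using gamma_weight_closed_form[OF ne, of t] unfolding len last card no2 by simp
  show "2 * card (Des_B n w) \<le> n + of_bool (n \<in> Des_B n w)" if "no_two_consecutive (Des_B n w)"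
    using gamma_weight_closed_form[OF ne, of t] that unfolding len last card no2 by simp
qed

section \<open>Palindromicity and the identification of both parts\<close>

lemma palindromic_sum: "(\<And>i. i \<in> I \<Longrightarrow> palindromic N (f i)) \<Longrightarrow> palindromic N (\<Sum>i\<in>I. f i)"
  by (simp add: palindromic_def poly_sum sum_distrib_left)

lemma palindromic_gamma_basis:
  assumes "2 * i \<le> N"
  shows "palindromic N (of_nat c * [:0, 1:] ^ i * [:1, 1:] ^ (N - 2 * i))"
  unfolding palindromic_def
proof (intro allI impI)
  fix t :: real assume t: "t \<noteq> 0"
  \<comment> \<open>One \<open>t ^ i\<close> cancels \<open>(1 / t) ^ i\<close>, the other is the
    power to be obtained, and the remaining factors turn each \<open>1 + 1 / t\<close> into
    \<open>1 + t\<close>.\<close>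
  have "t ^ N = t ^ i * t ^ i * t ^ (N - 2 * i)"
    using assms by (simp flip: power_add)
  moreover have "t ^ (N - 2 * i) * (1 + 1 / t) ^ (N - 2 * i) = (1 + t) ^ (N - 2 * i)"
  proof -
    have "t * (1 + 1 / t) = 1 + t" using t by (simp add: field_simps)
    then show ?thesis by (simp flip: power_mult_distrib)
  qed
  moreover have "t ^ i * (1 / t) ^ i = 1"
    unfolding power_mult_distrib[symmetric] using t by simp
  ultimately show "t ^ N * poly (of_nat c * [:0, 1:] ^ i * [:1, 1:] ^ (N - 2 * i)) (1 / t) =
      poly (of_nat c * [:0, 1:] ^ i * [:1, 1:] ^ (N - 2 * i)) t"
    by (simp add: mult_ac)
qed

theorem proposition8p6:
  fixes n :: nat
  assumes "n > 0"
  shows "B_tilde_plus n =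
           (\<Sum>i = 0..n div 2. of_nat (gamma_plus n i) * [:0, 1:] ^ i * [:1, 1:] ^ (n - 2 * i))
       \<and> B_tilde_minus n =
           (\<Sum>i = 1..(n + 1) div 2.
              of_nat (gamma_minus n i) * [:0, 1:] ^ i * [:1, 1:] ^ (n + 1 - 2 * i))"
    (is "_ = ?p \<and> _ = ?q")
proof -
  let ?X = "[:0, 1:] :: real poly" and ?Y = "[:1, 1:] :: real poly"
  let ?D = "Des_B n"
  \<comment> \<open>The other signed permutations have a double descent and weight
    \<open>0\<close>.\<close>
  define S where "S = {w \<in> signed_perms n. no_two_consecutive (?D w)}"
  have S: "finite S" unfolding S_def using finite_signed_perms by simp
  have bound: "2 * card (?D w) \<le> n + of_bool (n \<in> ?D w)" if "w \<in> S" for w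
    using that assms gamma_weight_signed_perm(2) unfolding S_def by blast
  have XY: "1 + ?X = ?Y" by (simp add: one_pCons)
  have "B_tilde n = (\<Sum>w\<in>signed_perms n. if no_two_consecutive (?D w) then
      ?X ^ card (?D w) * ?Y ^ (n + of_bool (n \<in> ?D w) - 2 * card (?D w)) else 0)"
    unfolding B_tilde_eq_signed_gamma_sum signed_gamma_sum_def
      sum.reindex_bij_betw[OF signed_words_eq_signed_perms, symmetric]
    by (intro sum.cong refl, subst gamma_weight_signed_perm(1)) (simp_all only: assms XY)
  also have "\<dots> = (\<Sum>w\<in>S. ?X ^ card (?D w) * ?Y ^ (n + of_bool (n \<in> ?D w) - 2 * card (?D w)))"
    unfolding S_def using finite_signed_perms by (rule sum.inter_filter[symmetric])
  \<comment> \<open>Whether \<open>n\<close> is a descent decides between the exponents based on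
    \<open>n\<close> and on \<open>n + 1\<close>, that is, between the two centers.\<close>
  also have "\<dots> = (\<Sum>w\<in>{w\<in>S. n \<notin> ?D w}. ?X ^ card (?D w) * ?Y ^ (n - 2 * card (?D w))) +
      (\<Sum>w\<in>{w\<in>S. n \<in> ?D w}. ?X ^ card (?D w) * ?Y ^ (n + 1 - 2 * card (?D w)))"
  proof -
    have "S = {w\<in>S. n \<notin> ?D w} \<union> {w\<in>S. n \<in> ?D w}" by auto
    then have "(\<Sum>w\<in>S. f w) = (\<Sum>w\<in>{w\<in>S. n \<notin> ?D w}. f w) + (\<Sum>w\<in>{w\<in>S. n \<in> ?D w}. f w)"
      for f :: "_ \<Rightarrow> real poly"
      using S by (metis (no_types, lifting) sum.union_disjoint finite_Un disjoint_iff mem_Collect_eq)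
    then show ?thesis by simp
  qed
  also have "(\<Sum>w\<in>{w\<in>S. n \<notin> ?D w}. ?X ^ card (?D w) * ?Y ^ (n - 2 * card (?D w))) = ?p"
  proof -
    have "(\<lambda>w. card (?D w)) ` {w\<in>S. n \<notin> ?D w} \<subseteq> {0..n div 2}" using bound by fastforce
    moreover have "{w\<in>{w\<in>S. n \<notin> ?D w}. card (?D w) = i} =
        {w \<in> signed_perms n. card (?D w) = i \<and> no_two_consecutive (?D w) \<and> n \<notin> ?D w}" for i
      by (auto simp: S_def)
    ultimately show ?thesis
      using S by (subst sum_by_value[of _ "{0..n div 2}"])
        (simp_all only: gamma_plus_def mult.assoc finite_Collect_conjI
          finite_atLeastAtMost simp_thms Collect_mem_eq)
  qed
  also have "(\<Sum>w\<in>{w\<in>S. n \<in> ?D w}. ?X ^ card (?D w) * ?Y ^ (n + 1 - 2 * card (?D w))) = ?q"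
  proof -
    \<comment> \<open>A descent at \<open>n\<close> makes the set nonempty, hence the lower limit 1
      of the second sum.\<close>
    have "card (?D w) > 0" if "n \<in> ?D w" for w
      using that by (auto simp: card_gt_0_iff Des_B_def)
    then have "(\<lambda>w. card (?D w)) ` {w\<in>S. n \<in> ?D w} \<subseteq> {1..(n + 1) div 2}"
      using bound by fastforce
    moreover have "{w\<in>{w\<in>S. n \<in> ?D w}. card (?D w) = i} =
        {w \<in> signed_perms n. card (?D w) = i \<and> no_two_consecutive (?D w) \<and> n \<in> ?D w}" for i
      by (auto simp: S_def)
    ultimately show ?thesis
      using S by (subst sum_by_value[of _ "{1..(n + 1) div 2}"])
        (simp_all only: gamma_minus_def mult.assoc finite_Collect_conjI
          finite_atLeastAtMost simp_thms Collect_mem_eq)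
  qed
  \<comment> \<open>Each summand is palindromic with center \<open>n / 2\<close> in the first sum
    and \<open>(n + 1) / 2\<close> in the second; uniqueness of the decomposition then identifies
    both sums.\<close>
  finally have "palindromic_decomp n (B_tilde n) ?p ?q"
    unfolding palindromic_decomp_def
    by (auto intro!: palindromic_sum palindromic_gamma_basis)
  then show ?thesis using palindromic_decomp_unique[OF B_tilde_decomp] by blast
qed

end
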